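(* Assume $\diamondsuit$. Then there is a special $\aleph_1$-tree which is Lindelöf with respect to the fine wedge topology.
   Context: $\diamondsuit$ asserts the existence of a sequence $\langle A_\alpha:\alpha<\omega_1\rangle$ with $A_\alpha\subseteq\alpha$ such that for every $A\subseteq\omega_1$ the set $\{\alpha<\omega_1:A\cap\alpha=A_\alpha\}$ is stationary. A tree is a strict partial order in which the predecessors of each node are well-ordered; an $\aleph_1$-tree is a tree of height $\omega_1$ with all levels countable. An $\aleph_1$-tree is special if it is a countable union of antichains (equivalently, admits an order-preserving map into $\mathbb{Q}$). For $t\in T$ let $\uparrow t=\{y\in T:t\le y\}$; the fine wedge topology on $T$ is generated by the subbase of all sets $\uparrow t$ and their complements. Lindelöf means every open cover has a countable subcover. *)

theory Defs
  imports "HOL-Analysis.Analysis" "HOL-Library.Countable_Set_Type"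
begin

unbundle cardinal_syntax

section \<open>The ordinal \<open>\<omega>\<^sub>1\<close>\<close>

text \<open>
  The elements of this type are the ordinals below \<open>\<omega>\<^sub>1\<close>; an ordinal \<open>\<alpha> < \<omega>\<^sub>1\<close> regarded as a set
  of ordinals is \<open>{..<\<alpha>}\<close>.
\<close>

typedef omega1 = "Field (cardSuc natLeq)"
proof -
  have "Field (cardSuc natLeq) \<noteq> {}"
    using Field_cardSuc_not_empty[OF natLeq_Card_order] .
  then show ?thesis by blast
qed

lemma Well_order_cardSuc_natLeq: "Well_order (cardSuc natLeq)"
  by (rule cardSuc_Well_order[OF natLeq_Card_order])

instantiation omega1 :: wellorder
begin

definition less_eq_omega1 :: "omega1 \<Rightarrow> omega1 \<Rightarrow> bool" where
  "\<alpha> \<le> \<beta> \<longleftrightarrow> (Rep_omega1 \<alpha>, Rep_omega1 \<beta>) \<in> cardSuc natLeq"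

definition less_omega1 :: "omega1 \<Rightarrow> omega1 \<Rightarrow> bool" where
  "\<alpha> < \<beta> \<longleftrightarrow> \<alpha> \<le> \<beta> \<and> \<alpha> \<noteq> (\<beta> :: omega1)"

instance
proof
  let ?r = "cardSuc natLeq"
  have lin: "Linear_order ?r" and wf: "wf (?r - Id)"
    using Well_order_cardSuc_natLeq by (auto simp: well_order_on_def)
  have refl: "refl_on (Field ?r) ?r" and trans: "trans ?r" and anti: "antisym ?r"
    and tot: "total_on (Field ?r) ?r"
    using lin by (auto simp: linear_order_on_def partial_order_on_def preorder_on_def)
  fix x y z :: omega1
  show le_refl: "x \<le> x"
    using refl Rep_omega1 by (auto simp: less_eq_omega1_def refl_on_def)
  show "x \<le> y \<Longrightarrow> y \<le> z \<Longrightarrow> x \<le> z"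
    using trans by (auto simp: less_eq_omega1_def elim: transE)
  show antisym: "x \<le> y \<Longrightarrow> y \<le> x \<Longrightarrow> x = y"
    using anti by (metis less_eq_omega1_def antisymD Rep_omega1_inject)
  show "x < y \<longleftrightarrow> x \<le> y \<and> \<not> y \<le> x"
    using le_refl antisym by (auto simp: less_omega1_def)
  show "x \<le> y \<or> y \<le> x"
    using tot le_refl Rep_omega1[of x] Rep_omega1[of y]
    by (cases "x = y") (auto simp: less_eq_omega1_def total_on_def Rep_omega1_inject)
  fix P :: "omega1 \<Rightarrow> bool" and a
  assume step: "\<And>x. (\<And>y. y < x \<Longrightarrow> P y) \<Longrightarrow> P x"
  have "wf {(x, y). x < (y :: omega1)}"
    by (rule wf_subset[OF wf_inv_image[OF wf, of Rep_omega1]])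
      (auto simp: less_omega1_def less_eq_omega1_def Rep_omega1_inject)
  then show "P a"
    by (induction a rule: wf_induct_rule) (use step in auto)
qed

end

lemma uncountable_omega1: "uncountable (UNIV :: omega1 set)"
proof
  assume "countable (UNIV :: omega1 set)"
  then have "countable (Field (cardSuc natLeq))"
    using type_definition.Rep_range[OF type_definition_omega1] by (metis countable_image)
  then have "|Field (cardSuc natLeq)| \<le>o natLeq"
    by (simp add: countable_card_le_natLeq)
  then have "cardSuc natLeq \<le>o natLeq"
    using card_of_Field_ordIso[OF cardSuc_Card_order[OF natLeq_Card_order]]
    by (meson ordIso_ordLeq_trans ordIso_symmetric)
  then show False
    using cardSuc_greater[OF natLeq_Card_order] not_ordLess_ordLeq by blast
qed

lemma countable_lessThan_omega1: "countable {..<\<alpha> :: omega1}"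
proof -
  have "|underS (cardSuc natLeq) (Rep_omega1 \<alpha>)| <o cardSuc natLeq"
    by (rule card_of_underS[OF cardSuc_Card_order[OF natLeq_Card_order] Rep_omega1])
  then have "countable (underS (cardSuc natLeq) (Rep_omega1 \<alpha>))"
    by (simp add: countable_card_le_natLeq cardSuc_ordLess_ordLeq cardSuc_ordLeq_ordLess
        natLeq_Card_order card_of_Card_order)
  moreover have "Rep_omega1 ` {..<\<alpha>} \<subseteq> underS (cardSuc natLeq) (Rep_omega1 \<alpha>)"
    by (auto simp: underS_def less_omega1_def less_eq_omega1_def Rep_omega1_inject)
  ultimately show ?thesis
    by (metis countable_subset countable_image_inj_on inj_on_subset subset_UNIV
        inj_on_def Rep_omega1_inject)
qed

section \<open>The diamond principle\<close>

text \<open>The premise says that \<open>\<alpha>\<close> is a nonzero ordinal in which \<open>C \<inter> \<alpha>\<close> is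
  unbounded; such an \<open>\<alpha>\<close> is necessarily a limit.\<close>

definition closed_omega1 :: "omega1 set \<Rightarrow> bool" where
  "closed_omega1 C \<longleftrightarrow>
     (\<forall>\<alpha>. {..<\<alpha>} \<noteq> {} \<and> (\<forall>\<beta><\<alpha>. \<exists>\<gamma>\<in>C. \<beta> < \<gamma> \<and> \<gamma> < \<alpha>) \<longrightarrow> \<alpha> \<in> C)"

definition unbounded_omega1 :: "omega1 set \<Rightarrow> bool" where
  "unbounded_omega1 C \<longleftrightarrow> (\<forall>\<beta>. \<exists>\<gamma>\<in>C. \<beta> < \<gamma>)"

definition club :: "omega1 set \<Rightarrow> bool" where
  "club C \<longleftrightarrow> closed_omega1 C \<and> unbounded_omega1 C"

definition stationary :: "omega1 set \<Rightarrow> bool" where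
  "stationary S \<longleftrightarrow> (\<forall>C. club C \<longrightarrow> S \<inter> C \<noteq> {})"

definition diamond :: bool where
  "diamond \<longleftrightarrow>
     (\<exists>A :: omega1 \<Rightarrow> omega1 set.
        (\<forall>\<alpha>. A \<alpha> \<subseteq> {..<\<alpha>}) \<and> (\<forall>X. stationary {\<alpha>. X \<inter> {..<\<alpha>} = A \<alpha>}))"

section \<open>Trees\<close>

text \<open>A tree is given by its set of nodes \<open>T\<close> and its strict order \<open>lt\<close>, of which only the
  restriction to \<open>T\<close> matters.\<close>

definition tree_preds :: "'a set \<Rightarrow> ('a \<Rightarrow> 'a \<Rightarrow> bool) \<Rightarrow> 'a \<Rightarrow> 'a set" where
  "tree_preds T lt t = {s \<in> T. lt s t}"

text \<open>Library well-orders are reflexive, hence the reflexive closure of \<open>lt\<close>.\<close>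

definition tree_pred_order :: "'a set \<Rightarrow> ('a \<Rightarrow> 'a \<Rightarrow> bool) \<Rightarrow> 'a \<Rightarrow> 'a rel" where
  "tree_pred_order T lt t =
     {(x, y). x \<in> tree_preds T lt t \<and> y \<in> tree_preds T lt t \<and> (x = y \<or> lt x y)}"

definition is_tree :: "'a set \<Rightarrow> ('a \<Rightarrow> 'a \<Rightarrow> bool) \<Rightarrow> bool" where
  "is_tree T lt \<longleftrightarrow>
     irreflp_on T lt \<and> transp_on T lt \<and>
     (\<forall>t\<in>T. well_order_on (tree_preds T lt t) (tree_pred_order T lt t))"

definition tree_level :: "'a set \<Rightarrow> ('a \<Rightarrow> 'a \<Rightarrow> bool) \<Rightarrow> omega1 \<Rightarrow> 'a set" where
  "tree_level T lt \<alpha> = {t \<in> T. tree_pred_order T lt t =o {(\<beta>, \<gamma>). \<beta> \<le> \<gamma> \<and> \<gamma> < \<alpha>}}"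

text \<open>The height of a tree is the least ordinal whose level is empty. It is \<open>\<omega>\<^sub>1\<close> iff all
  levels below \<open>\<omega>\<^sub>1\<close> are nonempty and every node lies on one of them.\<close>

definition height_omega1 :: "'a set \<Rightarrow> ('a \<Rightarrow> 'a \<Rightarrow> bool) \<Rightarrow> bool" where
  "height_omega1 T lt \<longleftrightarrow>
     (\<forall>\<alpha>. tree_level T lt \<alpha> \<noteq> {}) \<and> (\<forall>t\<in>T. \<exists>\<alpha>. t \<in> tree_level T lt \<alpha>)"

definition aleph1_tree :: "'a set \<Rightarrow> ('a \<Rightarrow> 'a \<Rightarrow> bool) \<Rightarrow> bool" where
  "aleph1_tree T lt \<longleftrightarrow>
     is_tree T lt \<and> height_omega1 T lt \<and> (\<forall>\<alpha>. countable (tree_level T lt \<alpha>))"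

definition tree_antichain :: "'a set \<Rightarrow> ('a \<Rightarrow> 'a \<Rightarrow> bool) \<Rightarrow> 'a set \<Rightarrow> bool" where
  "tree_antichain T lt A \<longleftrightarrow> A \<subseteq> T \<and> (\<forall>x\<in>A. \<forall>y\<in>A. \<not> lt x y)"

definition special_tree :: "'a set \<Rightarrow> ('a \<Rightarrow> 'a \<Rightarrow> bool) \<Rightarrow> bool" where
  "special_tree T lt \<longleftrightarrow>
     (\<exists>A :: nat \<Rightarrow> 'a set. (\<forall>n. tree_antichain T lt (A n)) \<and> T = (\<Union>n. A n))"

definition up_set :: "'a set \<Rightarrow> ('a \<Rightarrow> 'a \<Rightarrow> bool) \<Rightarrow> 'a \<Rightarrow> 'a set" where
  "up_set T lt t = {y \<in> T. t = y \<or> lt t y}"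

definition fine_wedge_topology :: "'a set \<Rightarrow> ('a \<Rightarrow> 'a \<Rightarrow> bool) \<Rightarrow> 'a topology" where
  "fine_wedge_topology T lt =
     topology_generated_by (up_set T lt ` T \<union> (\<lambda>t. T - up_set T lt t) ` T)"

lemma topspace_fine_wedge_topology: "topspace (fine_wedge_topology T lt) = T"
  unfolding fine_wedge_topology_def topology_generated_by_topspace by (auto simp: up_set_def)

end

theory Submission
  imports Defs
begin

text \<open>
  In the fine wedge topology, \<open>x\<close> has a neighbourhood base consisting of the sets \<open>\<up>x\<close> minus
  finitely many \<open>\<up>s\<close> with \<open>s\<close> an immediate successor of \<open>x\<close>. Hence a tree with countable levels is
  Lindelof iff for every set \<open>A\<close> of nodes containing only finitely many immediate successors of each
  node there is a level none of whose nodes has all its successor-level predecessors in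
  \<open>A\<close>. The usual recursive construction of a special Aronszajn tree, with rational labels and
  infinitely many immediate successors of arbitrarily close label above each node, leaves enough
  room to let every branch extended at a limit level \<open>\<alpha>\<close> leave the set \<open>A\<^sub>\<alpha>\<close> guessed by diamond:
  its first step above the given node avoids the finitely many immediate successors in \<open>A\<^sub>\<alpha>\<close>.
\<close>

section \<open>Countable ordinals\<close>

lemma ex_upper_bound_omega1:
  fixes S :: "omega1 set"
  assumes "countable S"
  shows "\<exists>\<beta>. \<forall>\<alpha>\<in>S. \<alpha> < \<beta>"
proof (rule ccontr)
  assume "\<not> ?thesis"
  then have "\<forall>\<beta>. \<exists>\<alpha>\<in>S. \<beta> \<le> \<alpha>"
    by (meson not_le)
  then have "UNIV = (\<Union>\<alpha>\<in>S. insert \<alpha> {..<\<alpha>})"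
    by (auto simp: order_le_less)
  moreover have "countable (\<Union>\<alpha>\<in>S. insert \<alpha> {..<\<alpha>})"
    using assms countable_lessThan_omega1 by auto
  ultimately show False
    using uncountable_omega1 by simp
qed

definition suc_omega1 :: "omega1 \<Rightarrow> omega1" where
  "suc_omega1 \<alpha> = (LEAST \<beta>. \<alpha> < \<beta>)"

lemma less_suc_omega1: "\<alpha> < suc_omega1 \<alpha>"
  unfolding suc_omega1_def using ex_upper_bound_omega1[of "{\<alpha>}"] by (auto intro: LeastI_ex)

lemma suc_omega1_le: "\<alpha> < \<beta> \<Longrightarrow> suc_omega1 \<alpha> \<le> \<beta>"
  unfolding suc_omega1_def by (rule Least_le)

lemma suc_omega1_inject: "suc_omega1 \<alpha> = suc_omega1 \<beta> \<Longrightarrow> \<alpha> = \<beta>"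
  by (metis less_suc_omega1 suc_omega1_le linorder_neq_iff not_less)

text \<open>For unboundedness, iterate \<omega> times a function that dominates \<open>h\<close>;
  the supremum of the iterates is closed under \<open>h\<close>.\<close>

lemma club_closure_points:
  fixes h :: "omega1 \<Rightarrow> omega1"
  shows "club {\<alpha>. {..<\<alpha>} \<noteq> {} \<and> (\<forall>\<beta><\<alpha>. h \<beta> < \<alpha>)}" (is "club ?C")
  unfolding club_def
proof
  show "closed_omega1 ?C"
    unfolding closed_omega1_def
  proof (intro allI impI, elim conjE)
    fix \<alpha>
    assume ne: "{..<\<alpha>} \<noteq> {}" and cofinal: "\<forall>\<beta><\<alpha>. \<exists>\<gamma>\<in>?C. \<beta> < \<gamma> \<and> \<gamma> < \<alpha>"
    have "h \<beta> < \<alpha>" if "\<beta> < \<alpha>" for \<beta>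
      using cofinal that order.strict_trans by blast
    then show "\<alpha> \<in> ?C"
      using ne by blast
  qed
  show "unbounded_omega1 ?C"
    unfolding unbounded_omega1_def
  proof
    fix \<beta>\<^sub>0
    have "\<exists>\<beta>. \<forall>\<gamma>\<in>insert \<alpha> (h ` insert \<alpha> {..<\<alpha>}). \<gamma> < \<beta>" for \<alpha>
      by (rule ex_upper_bound_omega1) (simp add: countable_lessThan_omega1)
    \<comment> \<open>\<open>k\<close> bounds \<open>h\<close> on whole segments, since an ordinal
      below the supremum is only known to lie below some iterate.\<close>
    then obtain k where k: "\<And>\<alpha>. \<alpha> < k \<alpha>" "\<And>\<alpha> \<gamma>. \<gamma> \<in> insert \<alpha> {..<\<alpha>} \<Longrightarrow> h \<gamma> < k \<alpha>"
      by (metis image_eqI insert_iff)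
    define s where "s n = (k ^^ n) \<beta>\<^sub>0" for n
    have s_Suc: "s (Suc n) = k (s n)" for n
      by (simp add: s_def)
    define \<alpha> where "\<alpha> = (LEAST \<beta>. \<forall>n. s n < \<beta>)"
    have "\<exists>\<beta>. \<forall>n. s n < \<beta>"
      using ex_upper_bound_omega1[of "range s"] by auto
    then have s_less: "s n < \<alpha>" for n
      unfolding \<alpha>_def by (rule LeastI2_ex) auto
    have cofinal: "\<exists>n. \<gamma> \<le> s n" if "\<gamma> < \<alpha>" for \<gamma>
      using not_less_Least[OF that[unfolded \<alpha>_def]] by (auto simp: not_less)
    have "h \<gamma> < \<alpha>" if \<gamma>: "\<gamma> < \<alpha>" for \<gamma>
    proof -
      obtain n where "\<gamma> \<le> s n"
        using cofinal \<gamma> by blast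
      then have "h \<gamma> < s (Suc n)"
        by (auto simp: s_Suc order_le_less intro: k)
      then show ?thesis
        using s_less order.strict_trans by blast
    qed
    moreover have "\<beta>\<^sub>0 < \<alpha>"
      using s_less[of 0] by (simp add: s_def)
    ultimately show "\<exists>\<gamma>\<in>?C. \<beta>\<^sub>0 < \<gamma>"
      by blast
  qed
qed

text \<open>Nodes can thus be coded by countable ordinals, so that diamond guesses sets of
  nodes.\<close>

lemma ex_bij_omega1_times_nat: "\<exists>N :: omega1 \<times> nat \<Rightarrow> omega1. bij N"
proof -
  have inf: "infinite (UNIV :: omega1 set)"
    using uncountable_omega1 countable_finite by blast
  have "|UNIV :: nat set| \<le>o |UNIV :: omega1 set|"
    using inf infinite_iff_card_of_nat by blast
  then have "|(UNIV :: omega1 set) \<times> (UNIV :: nat set)| =o |UNIV :: omega1 set|"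
    using inf card_of_Times_infinite_simps(1) by blast
  then show ?thesis
    by (simp add: card_of_ordIso[symmetric])
qed

section \<open>Order types of initial segments of \<open>omega1\<close>\<close>

definition segment_omega1 :: "omega1 \<Rightarrow> omega1 rel" where
  "segment_omega1 \<alpha> = {(\<beta>, \<gamma>). \<beta> \<le> \<gamma> \<and> \<gamma> < \<alpha>}"

lemma Field_segment_omega1: "Field (segment_omega1 \<alpha>) = {..<\<alpha>}"
  by (auto simp: Field_def segment_omega1_def)

lemma Well_order_segment_omega1: "Well_order (segment_omega1 \<alpha>)"
proof -
  have "wf (segment_omega1 \<alpha> - Id)"
    by (rule wf_subset[OF wf]) (auto simp: segment_omega1_def)
  then show ?thesis
    unfolding well_order_on_def linear_order_on_def partial_order_on_def preorder_on_def
      Field_segment_omega1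
    by (auto simp: refl_on_def trans_def antisym_def total_on_def segment_omega1_def)
qed

lemma segment_omega1_ordLess:
  assumes "\<alpha> < \<beta>"
  shows "segment_omega1 \<alpha> <o segment_omega1 \<beta>"
proof -
  have "Restr (segment_omega1 \<beta>) (underS (segment_omega1 \<beta>) \<alpha>) = segment_omega1 \<alpha>"
    using assms by (auto simp: underS_def segment_omega1_def)
  moreover have "Field (segment_omega1 \<beta>) \<noteq> {}"
    using assms by (auto simp: Field_segment_omega1)
  ultimately show ?thesis
    using underS_Restr_ordLess[OF Well_order_segment_omega1] by metis
qed

text \<open>Hence a node lies on only one level in the sense of \<open>tree_level\<close>.\<close>

lemma segment_omega1_ordIso_iff: "segment_omega1 \<alpha> =o segment_omega1 \<beta> \<longleftrightarrow> \<alpha> = \<beta>"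
  by (metis Well_order_segment_omega1 linorder_less_linear not_ordLess_ordIso ordIso_reflexive
      ordIso_symmetric segment_omega1_ordLess)

section \<open>Trees with levels indexed by the natural numbers\<close>

text \<open>\<open>N (\<alpha>, n)\<close> is the \<open>n\<close>-th node of level \<open>\<alpha>\<close>, and its predecessor on level \<open>\<beta>\<close> is
  \<open>N (\<beta>, p \<alpha> n \<beta>)\<close>; the values \<open>p \<alpha> n \<beta>\<close> with \<open>\<beta> > \<alpha>\<close> are junk.\<close>

locale indexed_tree =
  fixes N :: "omega1 \<times> nat \<Rightarrow> omega1"
    and p :: "omega1 \<Rightarrow> nat \<Rightarrow> omega1 \<Rightarrow> nat"
  assumes bij_N: "bij N"
    and p_self: "p \<alpha> n \<alpha> = n"
    and p_trans: "\<gamma> \<le> \<beta> \<Longrightarrow> \<beta> \<le> \<alpha> \<Longrightarrow> p \<beta> (p \<alpha> n \<beta>) \<gamma> = p \<alpha> n \<gamma>"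
begin

definition lev :: "omega1 \<Rightarrow> omega1" where "lev x = fst (inv N x)"
definition idx :: "omega1 \<Rightarrow> nat" where "idx x = snd (inv N x)"

definition proj :: "omega1 \<Rightarrow> omega1 \<Rightarrow> nat" where "proj x = p (lev x) (idx x)"

definition lt :: "omega1 \<Rightarrow> omega1 \<Rightarrow> bool" where
  "lt x y \<longleftrightarrow> lev x < lev y \<and> proj y (lev x) = idx x"

lemma lev_N [simp]: "lev (N (\<alpha>, n)) = \<alpha>" and idx_N [simp]: "idx (N (\<alpha>, n)) = n"
  using bij_N by (simp_all add: lev_def idx_def bij_is_inj)

lemma N_lev_idx [simp]: "N (lev x, idx x) = x"
  using bij_N by (simp add: lev_def idx_def bij_is_surj surj_f_inv_f)

lemma N_inject: "N a = N b \<longleftrightarrow> a = b"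
  using bij_N by (simp add: bij_is_inj inj_eq)

lemma node_eqI: "lev x = lev y \<Longrightarrow> idx x = idx y \<Longrightarrow> x = y"
  by (metis N_lev_idx)

lemma proj_N: "proj (N (\<alpha>, n)) = p \<alpha> n"
  by (simp add: proj_def)

lemma proj_below:
  assumes "x = y \<or> lt x y" "\<beta> \<le> lev x"
  shows "proj x \<beta> = proj y \<beta>"
  using assms p_trans[of \<beta> "lev x" "lev y" "idx y"] by (auto simp: lt_def proj_def)

lemma lt_N_proj: "\<beta> < lev y \<Longrightarrow> lt (N (\<beta>, proj y \<beta>)) y"
  by (simp add: lt_def)

lemma lt_trans: "lt x y \<Longrightarrow> lt y z \<Longrightarrow> lt x z"
  using proj_below[of y z "lev x"] by (auto simp: lt_def)

lemma lt_irrefl: "\<not> lt x x"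
  by (simp add: lt_def)

lemma comparable:
  assumes "lt x z" "y = z \<or> lt y z"
  shows "x = y \<or> lt x y \<or> lt y x"
proof -
  consider "lev x < lev y" | "lev x = lev y" | "lev y < lev x"
    by fastforce
  then show ?thesis
  proof cases
    case 1
    then show ?thesis
      using proj_below[OF assms(2), of "lev x"] assms(1) by (auto simp: lt_def)
  next
    case 2
    then show ?thesis
      using assms by (auto simp: lt_def intro: node_eqI)
  next
    case 3
    then show ?thesis
      using proj_below[of x z "lev y"] assms by (auto simp: lt_def)
  qed
qed

section \<open>The indexed tree as an aleph_1-tree\<close>

text \<open>Along a branch the tree order is the order of levels, so listing the predecessors of
  \<open>t\<close> by level is an order isomorphism.\<close>

lemma tree_pred_order_eq:
  "tree_pred_order UNIV lt t = dir_image (segment_omega1 (lev t)) (\<lambda>\<beta>. N (\<beta>, proj t \<beta>))"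
proof -
  have *: "x \<in> tree_preds UNIV lt t \<longleftrightarrow> (\<exists>\<beta><lev t. x = N (\<beta>, proj t \<beta>))" for x
    unfolding tree_preds_def using lt_N_proj[of _ t]
    by (auto simp: lt_def intro!: exI[of _ "lev x"])
  have **: "N (\<beta>, proj t \<beta>) = N (\<gamma>, proj t \<gamma>) \<or> lt (N (\<beta>, proj t \<beta>)) (N (\<gamma>, proj t \<gamma>)) \<longleftrightarrow> \<beta> \<le> \<gamma>"
    if "\<beta> < lev t" "\<gamma> < lev t" for \<beta> \<gamma>
    using that p_trans[of \<beta> \<gamma> "lev t" "idx t"]
    by (auto simp: N_inject lt_def proj_N proj_def order_le_less)
  show ?thesis
  proof (intro set_eqI iffI)
    fix z
    assume "z \<in> tree_pred_order UNIV lt t"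
    then obtain \<beta> \<gamma> where z: "\<beta> < lev t" "\<gamma> < lev t" "z = (N (\<beta>, proj t \<beta>), N (\<gamma>, proj t \<gamma>))"
      and "N (\<beta>, proj t \<beta>) = N (\<gamma>, proj t \<gamma>) \<or> lt (N (\<beta>, proj t \<beta>)) (N (\<gamma>, proj t \<gamma>))"
      unfolding tree_pred_order_def * by blast
    then have "\<beta> \<le> \<gamma>"
      using ** by blast
    then show "z \<in> dir_image (segment_omega1 (lev t)) (\<lambda>\<beta>. N (\<beta>, proj t \<beta>))"
      using z unfolding dir_image_def segment_omega1_def by blast
  next
    fix z
    assume "z \<in> dir_image (segment_omega1 (lev t)) (\<lambda>\<beta>. N (\<beta>, proj t \<beta>))"
    then obtain \<beta> \<gamma> where z: "z = (N (\<beta>, proj t \<beta>), N (\<gamma>, proj t \<gamma>))"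
      and le: "\<beta> \<le> \<gamma>" and \<gamma>: "\<gamma> < lev t"
      unfolding dir_image_def segment_omega1_def by blast
    then have "\<beta> < lev t"
      by simp
    then show "z \<in> tree_pred_order UNIV lt t"
      using z \<gamma> **[OF \<open>\<beta> < lev t\<close> \<gamma>] le unfolding tree_pred_order_def * by blast
  qed
qed

lemma inj_on_branch: "inj_on (\<lambda>\<beta>. N (\<beta>, proj t \<beta>)) B"
  by (auto simp: inj_on_def N_inject)

lemma tree_pred_order_ordIso: "tree_pred_order UNIV lt t =o segment_omega1 (lev t)"
  unfolding tree_pred_order_eq
  by (rule ordIso_symmetric[OF dir_image_ordIso[OF Well_order_segment_omega1 inj_on_branch]])

lemma tree_level_eq: "tree_level UNIV lt \<alpha> = {t. lev t = \<alpha>}"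
  unfolding tree_level_def segment_omega1_def[symmetric]
  using tree_pred_order_ordIso segment_omega1_ordIso_iff ordIso_symmetric ordIso_transitive
  by blast

lemma aleph1_tree: "aleph1_tree UNIV lt"
  unfolding aleph1_tree_def is_tree_def height_omega1_def
proof (intro conjI allI ballI)
  show "irreflp_on UNIV lt"
    by (simp add: irreflp_on_def lt_irrefl)
  show "transp_on UNIV lt"
    using lt_trans by (auto simp: transp_on_def)
  show "well_order_on (tree_preds UNIV lt t) (tree_pred_order UNIV lt t)" for t
  proof -
    have "Well_order (tree_pred_order UNIV lt t)"
      unfolding tree_pred_order_eq
      by (rule Well_order_dir_image[OF Well_order_segment_omega1 inj_on_branch])
    moreover have "Field (tree_pred_order UNIV lt t) = tree_preds UNIV lt t"
      by (auto simp: Field_def tree_pred_order_def)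
    ultimately show ?thesis
      by simp
  qed
  show "tree_level UNIV lt \<alpha> \<noteq> {}" for \<alpha>
    using lev_N[of \<alpha> 0] by (auto simp: tree_level_eq simp del: lev_N)
  show "\<exists>\<alpha>. t \<in> tree_level UNIV lt \<alpha>" for t
    by (simp add: tree_level_eq)
  have "tree_level UNIV lt \<alpha> \<subseteq> range (\<lambda>n. N (\<alpha>, n))" for \<alpha>
    by (metis (mono_tags, lifting) N_lev_idx mem_Collect_eq rangeI subsetI tree_level_eq)
  then show "countable (tree_level UNIV lt \<alpha>)" for \<alpha>
    by (meson countable_subset countable_image countableI_type)
qed

text \<open>The fibres of \<open>f\<close> over the countably many rationals are antichains.\<close>

lemma special_treeI:
  fixes f :: "omega1 \<Rightarrow> rat"
  assumes "\<And>x y. lt x y \<Longrightarrow> f x < f y"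
  shows "special_tree UNIV lt"
  unfolding special_tree_def
proof (intro exI conjI allI)
  show "tree_antichain UNIV lt {x. f x = nat_to_rat_surj n}" for n
    using assms by (fastforce simp: tree_antichain_def)
  show "UNIV = (\<Union>n. {x. f x = nat_to_rat_surj n})"
    using surj_nat_to_rat_surj by (auto simp: surj_def)
qed

section \<open>Neighbourhoods in the fine wedge topology and the Lindelof property\<close>

text \<open>Induction on the generation of open sets; for an intersection the two finite sets are
  united.\<close>

lemma fine_wedge_nhd:
  assumes "openin (fine_wedge_topology UNIV lt) U" "x \<in> U"
  shows "\<exists>F. finite F \<and> (\<forall>s\<in>F. lt x s) \<and> up_set UNIV lt x - (\<Union>s\<in>F. up_set UNIV lt s) \<subseteq> U"
  using assms unfolding fine_wedge_topology_def openin_topology_generated_by_iff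
proof (induction arbitrary: x)
  case Empty
  then show ?case by simp
next
  case (Int a b)
  then obtain F G where
    "finite F \<and> (\<forall>s\<in>F. lt x s) \<and> up_set UNIV lt x - (\<Union>s\<in>F. up_set UNIV lt s) \<subseteq> a"
    "finite G \<and> (\<forall>s\<in>G. lt x s) \<and> up_set UNIV lt x - (\<Union>s\<in>G. up_set UNIV lt s) \<subseteq> b"
    by (metis IntE)
  then show ?case
    by (intro exI[of _ "F \<union> G"]) blast
next
  case (UN K)
  then obtain k where k: "k \<in> K" "x \<in> k"
    by blast
  show ?case
    using UN.IH[OF k] k(1) by blast
next
  case (Basis s)
  then consider t where "s = up_set UNIV lt t" | t where "s = UNIV - up_set UNIV lt t"
    by blast
  then show ?case
  proof cases
    case 1
    then show ?thesis
      using Basis lt_trans by (intro exI[of _ "{}"]) (auto simp: up_set_def)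
  next
    case (2 t)
    show ?thesis
    proof (cases "lt x t")
      case True
      then show ?thesis
        using 2 by (intro exI[of _ "{t}"]) auto
    next
      case False
      \<comment> \<open>If \<open>y\<close> were above both, \<open>x\<close> and \<open>t\<close>
        would be comparable; but \<open>x\<close> avoids \<open>up_set UNIV lt t\<close>, and
        \<open>lt x t\<close> is excluded.\<close>
      have "y \<notin> up_set UNIV lt t" if "y \<in> up_set UNIV lt x" for y
        using that False 2 Basis(2) comparable[of x y t] comparable[of t y x]
        by (auto simp: up_set_def)
      then show ?thesis
        using 2 by (intro exI[of _ "{}"]) auto
    qed
  qed
qed

text \<open>A neighbourhood assignment \<open>x \<mapsto> \<up>x - (\<Union>s\<in>F x. \<up>s)\<close> is coded by the single set \<open>A\<close> of those
  nodes on level \<open>lev x + 1\<close> that lie below some \<open>s \<in> F x\<close>; by finiteness of \<open>F x\<close>, the set \<open>A\<close>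
  contains only finitely many immediate successors of each node.\<close>

lemma Lindelof_space_fine_wedge:
  assumes diamond: "\<And>X. stationary {\<alpha>. X \<inter> {..<\<alpha>} = A \<alpha>}"
    and leaves: "\<And>\<alpha> n. \<exists>\<beta>. \<beta> < \<alpha> \<Longrightarrow> (\<And>\<beta>. \<beta> < \<alpha> \<Longrightarrow> suc_omega1 \<beta> < \<alpha>) \<Longrightarrow>
      (\<And>\<beta> m. \<beta> < \<alpha> \<Longrightarrow>
        finite {k. N (suc_omega1 \<beta>, k) \<in> A \<alpha> \<and> p (suc_omega1 \<beta>) k \<beta> = m}) \<Longrightarrow>
      \<exists>\<beta><\<alpha>. N (suc_omega1 \<beta>, p \<alpha> n (suc_omega1 \<beta>)) \<notin> A \<alpha>"
  shows "Lindelof_space (fine_wedge_topology UNIV lt)"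
  unfolding Lindelof_space_def topspace_fine_wedge_topology
proof (intro allI impI, elim conjE)
  fix \<U>
  assume "\<forall>U\<in>\<U>. openin (fine_wedge_topology UNIV lt) U" and cover: "\<Union> \<U> = UNIV"
  then have "\<exists>U F. U \<in> \<U> \<and> x \<in> U \<and> finite F \<and> (\<forall>s\<in>F. lt x s) \<and>
      up_set UNIV lt x - (\<Union>s\<in>F. up_set UNIV lt s) \<subseteq> U" for x
    using fine_wedge_nhd by (metis UNIV_I UnionE)
  then obtain U F where U: "\<And>x. U x \<in> \<U>" "\<And>x. x \<in> U x" and fin: "\<And>x. finite (F x)"
    and F: "\<And>x s. s \<in> F x \<Longrightarrow> lt x s"
    and sub: "\<And>x. up_set UNIV lt x - (\<Union>s\<in>F x. up_set UNIV lt s) \<subseteq> U x"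
    by metis
  \<comment> \<open>This is the coding set described above; \<open>A\<close> denotes the diamond
    sequence here.\<close>
  define X where "X = {N (suc_omega1 (lev x), proj s (suc_omega1 (lev x))) |x s. s \<in> F x}"
  \<comment> \<open>Since successors are injective and \<open>lt x s\<close>, only
    \<open>x = N (\<beta>, m)\<close> contributes, so \<open>k\<close> comes from one of the
    finitely many \<open>s \<in> F x\<close>.\<close>
  have fin_X: "finite {k. N (suc_omega1 \<beta>, k) \<in> X \<and> p (suc_omega1 \<beta>) k \<beta> = m}" for \<beta> m
  proof (rule finite_subset)
    show "{k. N (suc_omega1 \<beta>, k) \<in> X \<and> p (suc_omega1 \<beta>) k \<beta> = m}
      \<subseteq> (\<lambda>s. proj s (suc_omega1 \<beta>)) ` F (N (\<beta>, m))"
    proof safe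
      fix k
      assume "N (suc_omega1 \<beta>, k) \<in> X"
      then obtain x s where s: "s \<in> F x" and eq: "suc_omega1 \<beta> = suc_omega1 (lev x)"
        and k: "k = proj s (suc_omega1 \<beta>)"
        by (auto simp: X_def N_inject)
      have \<beta>: "lev x = \<beta>"
        using suc_omega1_inject[OF eq] by simp
      have xs: "\<beta> < lev s" "proj s \<beta> = idx x"
        using F[OF s] \<beta> by (auto simp: lt_def)
      have "p (suc_omega1 \<beta>) k \<beta> = idx x"
        using p_trans[of \<beta> "suc_omega1 \<beta>" "lev s" "idx s"] less_suc_omega1[of \<beta>]
          suc_omega1_le[OF xs(1)] xs(2) k by (simp add: proj_def)
      then have "x = N (\<beta>, p (suc_omega1 \<beta>) k \<beta>)"
        using \<beta> N_lev_idx[of x] by simp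
      then show "k \<in> (\<lambda>s. proj s (suc_omega1 \<beta>)) ` F (N (\<beta>, p (suc_omega1 \<beta>) k \<beta>))"
        using s k by blast
    qed
  qed (simp add: fin)
  \<comment> \<open>A nonzero closure point \<alpha> of \<open>h\<close> is a limit, and all nodes
    on levels below \<alpha> are themselves below \<alpha>; a correct guess there knows
    \<open>X\<close> on all these levels.\<close>
  have "\<exists>\<gamma>. \<forall>\<delta>\<in>insert (suc_omega1 \<beta>) (range (\<lambda>n. N (\<beta>, n))). \<delta> < \<gamma>" for \<beta>
    by (rule ex_upper_bound_omega1) simp
  then obtain h where h: "\<And>\<beta>. suc_omega1 \<beta> < h \<beta>" "\<And>\<beta> n. N (\<beta>, n) < h \<beta>"
    by simp metis
  obtain \<alpha> where \<alpha>: "X \<inter> {..<\<alpha>} = A \<alpha>" "{..<\<alpha>} \<noteq> {}" "\<And>\<beta>. \<beta> < \<alpha> \<Longrightarrow> h \<beta> < \<alpha>"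
    using diamond[of X] club_closure_points[of h] unfolding stationary_def by blast
  have suc: "suc_omega1 \<beta> < \<alpha>" and N_less: "N (\<beta>, n) < \<alpha>" if "\<beta> < \<alpha>" for \<beta> n
    using h \<alpha>(3)[OF that] order.strict_trans by blast+
  have leave: "\<exists>\<beta><\<alpha>. N (suc_omega1 \<beta>, p \<alpha> n (suc_omega1 \<beta>)) \<notin> A \<alpha>" for n
  proof (rule leaves)
    show "finite {k. N (suc_omega1 \<beta>, k) \<in> A \<alpha> \<and> p (suc_omega1 \<beta>) k \<beta> = m}" for \<beta> m
      by (rule finite_subset[OF _ fin_X[of \<beta> m]]) (use \<alpha>(1) in blast)
  qed (use \<alpha>(2) suc in auto)
  \<comment> \<open>A node on level \<alpha> or higher has a branch that misses \<open>X\<close> on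
    some level \<open>suc_omega1 \<beta>\<close> below \<alpha>; the set chosen for its predecessor
    on level \<beta> then contains it.\<close>
  let ?V = "U ` {x. lev x < \<alpha>}"
  have "y \<in> \<Union> ?V" for y
  proof (cases "lev y < \<alpha>")
    case True
    then show ?thesis
      using U by blast
  next
    case False
    then have le: "\<alpha> \<le> lev y"
      by simp
    obtain \<beta> where \<beta>: "\<beta> < \<alpha>" "N (suc_omega1 \<beta>, p \<alpha> (proj y \<alpha>) (suc_omega1 \<beta>)) \<notin> A \<alpha>"
      using leave by blast
    have "p \<alpha> (proj y \<alpha>) (suc_omega1 \<beta>) = proj y (suc_omega1 \<beta>)"
      using p_trans[of "suc_omega1 \<beta>" \<alpha> "lev y" "idx y"] suc[OF \<beta>(1)] le
      by (simp add: proj_def)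
    then have notX: "N (suc_omega1 \<beta>, proj y (suc_omega1 \<beta>)) \<notin> X"
      using \<beta>(2) \<alpha>(1) N_less[OF suc[OF \<beta>(1)]] by auto
    define x where "x = N (\<beta>, proj y \<beta>)"
    have xy: "lt x y" and lx: "lev x = \<beta>"
      using lt_N_proj[of \<beta> y] \<beta>(1) le by (auto simp: x_def)
    \<comment> \<open>Otherwise \<open>s\<close> and \<open>y\<close> have the same projection to
      level \<open>suc_omega1 \<beta>\<close>, which \<open>X\<close> contains on account of
      \<open>s\<close>.\<close>
    have "y \<notin> up_set UNIV lt s" if s: "s \<in> F x" for s
    proof
      assume "y \<in> up_set UNIV lt s"
      then have "s = y \<or> lt s y"
        by (simp add: up_set_def)
      moreover have "suc_omega1 \<beta> \<le> lev s"
        using F[OF s] lx by (auto simp: lt_def intro: suc_omega1_le)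
      ultimately have "proj s (suc_omega1 \<beta>) = proj y (suc_omega1 \<beta>)"
        by (rule proj_below)
      then show False
        using notX s lx by (auto simp: X_def)
    qed
    then have "y \<in> U x"
      using sub[of x] xy by (auto simp: up_set_def)
    then show ?thesis
      using lx \<beta>(1) by blast
  qed
  moreover have "countable ?V"
  proof -
    have "{x. lev x < \<alpha>} \<subseteq> N ` ({..<\<alpha>} \<times> UNIV)"
      by (metis (mono_tags, lifting) N_lev_idx SigmaI UNIV_I imageI lessThan_iff mem_Collect_eq
          subsetI)
    then have "countable {x. lev x < \<alpha>}"
      by (rule countable_subset) (simp add: countable_lessThan_omega1)
    then show ?thesis by simp
  qed
  ultimately show "\<exists>\<V>. countable \<V> \<and> \<V> \<subseteq> \<U> \<and> \<Union> \<V> = UNIV"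
    using U(1) by (intro exI[of _ ?V]) auto
qed

end

section \<open>Construction of the levels\<close>

text \<open>\<open>g \<beta>\<close> consists of the projections and the rational labels of the nodes of level \<open>\<beta>\<close>, and \<open>r\<close> is
  a candidate for level \<open>\<alpha>\<close>. The set \<open>G\<close> is the guess at stage \<open>\<alpha>\<close>.\<close>

type_synonym level = "(nat \<Rightarrow> omega1 \<Rightarrow> nat) \<times> (nat \<Rightarrow> rat)"

text \<open>A branch through all levels below \<alpha>, given by its indices, with labels below
  \<open>q\<close>, the label intended for a node on top of it. The value at \<alpha> is left
  free.\<close>

definition coherent :: "(omega1 \<Rightarrow> level) \<Rightarrow> omega1 \<Rightarrow> rat \<Rightarrow> (omega1 \<Rightarrow> nat) \<Rightarrow> bool" where
  "coherent g \<alpha> q b \<longleftrightarrow>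
     (\<forall>\<beta><\<alpha>. snd (g \<beta>) (b \<beta>) < q \<and> (\<forall>\<gamma>\<le>\<beta>. fst (g \<beta>) (b \<beta>) \<gamma> = b \<gamma>))"

text \<open>For nonzero \<alpha> the first conjunct makes \<alpha> a limit, so every node below
  level \<alpha> has its immediate successors below level \<alpha> too.\<close>

definition small_guess :: "(omega1 \<Rightarrow> level) \<Rightarrow> omega1 \<Rightarrow> (omega1 \<times> nat) set \<Rightarrow> bool" where
  "small_guess g \<alpha> G \<longleftrightarrow>
     (\<forall>\<beta><\<alpha>. suc_omega1 \<beta> < \<alpha> \<and>
        (\<forall>m. finite {k. (suc_omega1 \<beta>, k) \<in> G \<and> fst (g (suc_omega1 \<beta>)) k \<beta> = m}))"

definition leaves_guess :: "omega1 \<Rightarrow> (omega1 \<times> nat) set \<Rightarrow> (omega1 \<Rightarrow> nat) \<Rightarrow> bool" where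
  "leaves_guess \<alpha> G b \<longleftrightarrow> (\<exists>\<beta><\<alpha>. (suc_omega1 \<beta>, b (suc_omega1 \<beta>)) \<notin> G)"

text \<open>The second clause carries the recursion through limits; asking for infinitely many
  extensions lets a branch avoid finitely many of them.\<close>

definition good_level ::
    "(omega1 \<times> nat) set \<Rightarrow> (omega1 \<Rightarrow> level) \<Rightarrow> omega1 \<Rightarrow> level \<Rightarrow> bool" where
  "good_level G g \<alpha> r \<longleftrightarrow>
     (\<forall>n. fst r n \<alpha> = n \<and> coherent g \<alpha> (snd r n) (fst r n)) \<and>
     (\<forall>\<gamma><\<alpha>. \<forall>m q. snd (g \<gamma>) m < q \<longrightarrow> infinite {n. fst r n \<gamma> = m \<and> snd r n < q}) \<and>
     ((\<exists>\<beta>. \<beta> < \<alpha>) \<and> small_guess g \<alpha> G \<longrightarrow> (\<forall>n. leaves_guess \<alpha> G (fst r n)))"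

text \<open>The well-founded choice in \<open>ex_good_levels\<close> requires this dependence on
  lower levels only.\<close>

lemma good_level_cong:
  assumes "\<And>\<beta>. \<beta> < \<alpha> \<Longrightarrow> g \<beta> = g' \<beta>"
  shows "good_level G g \<alpha> r \<longleftrightarrow> good_level G g' \<alpha> r"
proof -
  have "coherent g \<alpha> q b \<longleftrightarrow> coherent g' \<alpha> q b" for q b
    using assms by (auto simp: coherent_def)
  moreover have "small_guess g \<alpha> G \<longleftrightarrow> small_guess g' \<alpha> G"
    using assms by (auto simp: small_guess_def)
  moreover have "(\<forall>\<gamma><\<alpha>. \<forall>m q. snd (g \<gamma>) m < q \<longrightarrow> R \<gamma> m q) \<longleftrightarrow>
      (\<forall>\<gamma><\<alpha>. \<forall>m q. snd (g' \<gamma>) m < q \<longrightarrow> R \<gamma> m q)" for R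
    using assms by simp
  ultimately show ?thesis
    unfolding good_level_def by simp
qed

section \<open>Branches through the levels below \<alpha>\<close>

text \<open>Climb from the given node in \<omega> steps along an enumeration of the levels below
  \<alpha>, keeping labels below \<open>q\<close>; the nodes reached determine the branch. Successor
  and limit \<alpha> are treated alike.\<close>

lemma ex_coherent:
  assumes g: "\<And>\<beta>. \<beta> < \<alpha> \<Longrightarrow> good_level (G \<beta>) g \<beta> (g \<beta>)"
    and \<gamma>: "\<gamma> < \<alpha>" and q: "snd (g \<gamma>) m < q"
  shows "\<exists>b. coherent g \<alpha> q b \<and> b \<gamma> = m"
proof -
  define p where "p \<beta> = fst (g \<beta>)" for \<beta>
  define f where "f \<beta> = snd (g \<beta>)" for \<beta>
  have p_self: "p \<beta> n \<beta> = n" if "\<beta> < \<alpha>" for \<beta> n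
    using g[OF that] by (simp add: good_level_def p_def)
  have p_trans: "p \<delta> (p \<beta> n \<delta>) \<epsilon> = p \<beta> n \<epsilon>" if "\<epsilon> \<le> \<delta>" "\<delta> \<le> \<beta>" "\<beta> < \<alpha>" for \<delta> \<epsilon> \<beta> n
    using that g[OF that(3)] p_self[OF that(3)]
    by (cases "\<delta> = \<beta>") (auto simp: good_level_def coherent_def p_def)
  have f_less: "f \<delta> (p \<beta> n \<delta>) < f \<beta> n" if "\<delta> < \<beta>" "\<beta> < \<alpha>" for \<delta> \<beta> n
    using that g[OF that(2)] by (auto simp: good_level_def coherent_def p_def f_def)
  have ext: "\<exists>n'. p \<beta> n' \<delta> = n \<and> f \<beta> n' < q" if "\<delta> \<le> \<beta>" "\<beta> < \<alpha>" "f \<delta> n < q" for \<delta> \<beta> n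
  proof (cases "\<delta> = \<beta>")
    case True
    then show ?thesis
      using that p_self by blast
  next
    case False
    then have "infinite {n'. p \<beta> n' \<delta> = n \<and> f \<beta> n' < q}"
      using that g[OF that(2)] by (auto simp: good_level_def p_def f_def)
    then show ?thesis
      using infinite_imp_nonempty by blast
  qed
  define en where "en = from_nat_into {..<\<alpha>}"
  have en: "en i < \<alpha>" for i
    using from_nat_into[of "{..<\<alpha>}" i] \<gamma> by (auto simp: en_def)
  \<comment> \<open>\<open>x i\<close> is a pair of level and index; step \<open>i\<close> climbs to
    level \<open>en i\<close> unless that level has been reached already.\<close>
  have "\<exists>x. \<forall>i::nat. (fst (x i) < \<alpha> \<and> f (fst (x i)) (snd (x i)) < q \<and> (i = 0 \<longrightarrow> x i = (\<gamma>, m))) \<and>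
      (fst (x (Suc i)) = max (fst (x i)) (en i) \<and>
       p (fst (x (Suc i))) (snd (x (Suc i))) (fst (x i)) = snd (x i))"
  proof (rule dependent_nat_choice)
    show "\<exists>x. fst x < \<alpha> \<and> f (fst x) (snd x) < q \<and> (0 = (0::nat) \<longrightarrow> x = (\<gamma>, m))"
      using \<gamma> q by (intro exI[of _ "(\<gamma>, m)"]) (simp add: f_def)
    fix x and i :: nat
    assume x: "fst x < \<alpha> \<and> f (fst x) (snd x) < q \<and> (i = 0 \<longrightarrow> x = (\<gamma>, m))"
    define \<beta> where "\<beta> = max (fst x) (en i)"
    have "fst x \<le> \<beta>" "\<beta> < \<alpha>"
      using x en[of i] by (auto simp: \<beta>_def)
    then obtain n' where "p \<beta> n' (fst x) = snd x" "f \<beta> n' < q"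
      using ext x by blast
    then show "\<exists>y. (fst y < \<alpha> \<and> f (fst y) (snd y) < q \<and> (Suc i = 0 \<longrightarrow> y = (\<gamma>, m))) \<and>
      (fst y = max (fst x) (en i) \<and> p (fst y) (snd y) (fst x) = snd x)"
      using \<open>\<beta> < \<alpha>\<close> by (intro exI[of _ "(\<beta>, n')"]) (simp add: \<beta>_def)
  qed
  then obtain x where x_less: "\<And>i. fst (x i) < \<alpha>" and x_f: "\<And>i. f (fst (x i)) (snd (x i)) < q"
    and x_0: "x 0 = (\<gamma>, m)"
    and x_Suc: "\<And>i. fst (x (Suc i)) = max (fst (x i)) (en i)"
    and x_p: "\<And>i. p (fst (x (Suc i))) (snd (x (Suc i))) (fst (x i)) = snd (x i)"
    by blast
  define c where "c i = p (fst (x i)) (snd (x i))" for i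
  have mono: "fst (x i) \<le> fst (x j)" if "i \<le> j" for i j
    using that by (rule lift_Suc_mono_le[rotated]) (simp add: x_Suc)
  have c_le: "c j \<delta> = c i \<delta>" if "i \<le> j" "\<delta> \<le> fst (x i)" for i j \<delta>
    using that
  proof (induction rule: dec_induct)
    case (step j)
    have "\<delta> \<le> fst (x j)"
      using step mono[of i j] by simp
    then show ?case
      using step p_trans[of \<delta> "fst (x j)" "fst (x (Suc j))" "snd (x (Suc j))"] x_p[of j]
        x_less mono[of j "Suc j"] by (simp add: c_def)
  qed simp
  have c_eq: "c j \<delta> = c i \<delta>" if "\<delta> \<le> fst (x i)" "\<delta> \<le> fst (x j)" for i j \<delta>
    using c_le that by (metis linear)
  have ex: "\<exists>i. \<delta> \<le> fst (x i)" if \<delta>: "\<delta> < \<alpha>" for \<delta>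
  proof -
    obtain i where "en i = \<delta>"
      using from_nat_into_surj[OF countable_lessThan_omega1, of \<delta> \<alpha>] \<delta>
      by (auto simp: en_def)
    then show ?thesis
      by (intro exI[of _ "Suc i"]) (simp add: x_Suc)
  qed
  \<comment> \<open>By \<open>c_eq\<close> the choice of \<open>i\<close> is immaterial.\<close>
  define b where "b \<delta> = c (SOME i. \<delta> \<le> fst (x i)) \<delta>" for \<delta>
  have b: "b \<delta> = c i \<delta>" if "\<delta> \<le> fst (x i)" for \<delta> i
    unfolding b_def using that c_eq someI[of "\<lambda>i. \<delta> \<le> fst (x i)" i] by blast
  have "coherent g \<alpha> q b"
    unfolding coherent_def f_def[symmetric] p_def[symmetric]
  proof (intro allI impI conjI)
    fix \<beta>
    assume "\<beta> < \<alpha>"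
    then obtain i where i: "\<beta> \<le> fst (x i)"
      using ex by blast
    show "f \<beta> (b \<beta>) < q"
      using i b[OF i] x_f[of i] x_less[of i] f_less[of \<beta> "fst (x i)" "snd (x i)"]
        p_self[OF x_less, of i]
      by (cases "\<beta> = fst (x i)") (force simp: c_def)+
    fix \<delta>
    assume "\<delta> \<le> \<beta>"
    then show "p \<beta> (b \<beta>) \<delta> = b \<delta>"
      using i b[OF i] b[of \<delta> i] p_trans[of \<delta> \<beta> "fst (x i)" "snd (x i)"] x_less[of i]
      by (simp add: c_def)
  qed
  moreover have "b \<gamma> = m"
    using b[of \<gamma> 0] x_0 \<gamma> p_self by (simp add: c_def)
  ultimately show ?thesis by blast
qed

text \<open>If the guess is small, infinitely many immediate successors of the node have label below
  \<open>q\<close> and only finitely many lie in \<open>H\<close>; a branch through one outside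
  \<open>H\<close> is taken.\<close>

lemma ex_coherent_leaving:
  assumes g: "\<And>\<beta>. \<beta> < \<alpha> \<Longrightarrow> good_level (G \<beta>) g \<beta> (g \<beta>)"
    and \<gamma>: "\<gamma> < \<alpha>" and q: "snd (g \<gamma>) m < q"
  shows "\<exists>b. coherent g \<alpha> q b \<and> b \<gamma> = m \<and> (small_guess g \<alpha> H \<longrightarrow> leaves_guess \<alpha> H b)"
proof (cases "small_guess g \<alpha> H")
  case True
  let ?s = "suc_omega1 \<gamma>"
  have s: "\<gamma> < ?s" "?s < \<alpha>" and fin: "finite {k. (?s, k) \<in> H \<and> fst (g ?s) k \<gamma> = m}"
    using True \<gamma> less_suc_omega1 by (auto simp: small_guess_def)
  have "infinite {n. fst (g ?s) n \<gamma> = m \<and> snd (g ?s) n < q}"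
    using g[OF s(2)] s(1) q by (simp add: good_level_def)
  then have "\<not> {n. fst (g ?s) n \<gamma> = m \<and> snd (g ?s) n < q}
      \<subseteq> {k. (?s, k) \<in> H \<and> fst (g ?s) k \<gamma> = m}"
    using finite_subset[OF _ fin] by blast
  then obtain n where n: "fst (g ?s) n \<gamma> = m" "snd (g ?s) n < q" "(?s, n) \<notin> H"
    by blast
  obtain b where b: "coherent g \<alpha> q b" "b ?s = n"
    using ex_coherent[OF g s(2) n(2)] by blast
  have "b \<gamma> = m"
    using b s n(1) by (auto simp: coherent_def)
  moreover have "leaves_guess \<alpha> H b"
    using \<gamma> b(2) n(3) by (auto simp: leaves_guess_def)
  ultimately show ?thesis
    using b(1) by blast
next
  case False
  then show ?thesis
    using ex_coherent[OF g \<gamma> q] by blast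
qed

lemma ex_good_level:
  assumes g: "\<And>\<beta>. \<beta> < \<alpha> \<Longrightarrow> good_level (G \<beta>) g \<beta> (g \<beta>)"
  shows "\<exists>r. good_level (G \<alpha>) g \<alpha> r"
proof (cases "\<exists>\<beta>. \<beta> < \<alpha>")
  case False
  then have "good_level (G \<alpha>) g \<alpha> (\<lambda>n _. n, \<lambda>_. 0)"
    by (auto simp: good_level_def coherent_def)
  then show ?thesis ..
next
  case True
  then obtain \<beta>\<^sub>0 where \<beta>\<^sub>0: "\<beta>\<^sub>0 < \<alpha>" ..
  \<comment> \<open>Every node below level \<open>\<alpha>\<close> gets, for every bound \<open>q\<close> above its label, infinitely many
    extensions with label \<open>q\<close>; the last component of \<open>D\<close> numbers them.\<close>
  define D where "D = {(\<gamma>, m, q, k :: nat). \<gamma> < \<alpha> \<and> snd (g \<gamma>) m < q}"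
  have "D \<subseteq> {..<\<alpha>} \<times> UNIV"
    by (auto simp: D_def)
  then have D_countable: "countable D"
    by (rule countable_subset) (simp add: countable_lessThan_omega1)
  have "(\<beta>\<^sub>0, 0, snd (g \<beta>\<^sub>0) 0 + 1, 0) \<in> D"
    using \<beta>\<^sub>0 by (simp add: D_def)
  then have D_ne: "D \<noteq> {}" by blast
  define d where "d = from_nat_into D"
  \<comment> \<open>The \<open>n\<close>-th new node is to extend node \<open>m n\<close> of level
    \<open>l n\<close> and to carry the label \<open>f n\<close>.\<close>
  define l m f where "l n = fst (d n)" and "m n = fst (snd (d n))"
    and "f n = fst (snd (snd (d n)))" for n
  have "\<exists>b. coherent g \<alpha> (f n) b \<and> b (l n) = m n \<and>
      (small_guess g \<alpha> (G \<alpha>) \<longrightarrow> leaves_guess \<alpha> (G \<alpha>) b)" for n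
  proof (rule ex_coherent_leaving[OF g])
    show "l n < \<alpha>" "snd (g (l n)) (m n) < f n"
      using from_nat_into[OF D_ne, of n, folded d_def] by (auto simp: D_def l_def m_def f_def)
  qed
  then obtain b where b: "\<And>n. coherent g \<alpha> (f n) (b n)" "\<And>n. b n (l n) = m n"
    "\<And>n. small_guess g \<alpha> (G \<alpha>) \<Longrightarrow> leaves_guess \<alpha> (G \<alpha>) (b n)"
    by metis
  \<comment> \<open>A node must be its own projection to level \<alpha>, where
    \<open>coherent\<close> leaves the value open.\<close>
  define p where "p n = (b n)(\<alpha> := n)" for n
  have "coherent g \<alpha> (f n) (p n)" for n
    using b(1)[of n] by (auto simp: coherent_def p_def)
  moreover have "infinite {n. p n \<gamma> = i \<and> f n < q}"
    if \<gamma>: "\<gamma> < \<alpha>" and q: "snd (g \<gamma>) i < q" for \<gamma> i q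
  proof -
    \<comment> \<open>New labels equal the requested bound, so a bound strictly below
      \<open>q\<close> is requested.\<close>
    obtain q' where q': "snd (g \<gamma>) i < q'" "q' < q"
      using dense[OF q] by blast
    have "\<exists>n. d n = (\<gamma>, i, q', k)" for k
      using from_nat_into_surj[OF D_countable, of "(\<gamma>, i, q', k)"] \<gamma> q'
      by (auto simp: d_def D_def)
    then obtain e where e: "\<And>k. d (e k) = (\<gamma>, i, q', k)" by metis
    have "inj e"
      by (metis e injI prod.inject)
    moreover have "p (e k) \<gamma> = i \<and> f (e k) < q" for k
      using b(2)[of "e k"] \<gamma> q' by (auto simp: p_def l_def m_def f_def e)
    then have "range e \<subseteq> {n. p n \<gamma> = i \<and> f n < q}"
      by blast
    ultimately show ?thesis
      using infinite_super range_inj_infinite by blast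
  qed
  moreover have "leaves_guess \<alpha> (G \<alpha>) (p n)" if small: "small_guess g \<alpha> (G \<alpha>)" for n
  proof -
    \<comment> \<open>The update at \<alpha> thus spares the successor levels on which leaving is
      witnessed.\<close>
    have "suc_omega1 \<beta> \<noteq> \<alpha>" if "\<beta> < \<alpha>" for \<beta>
      using small that unfolding small_guess_def by blast
    then show ?thesis
      using b(3)[OF small, of n] by (auto simp: leaves_guess_def p_def)
  qed
  ultimately have "good_level (G \<alpha>) g \<alpha> (p, f)"
    by (simp add: good_level_def p_def)
  then show ?thesis ..
qed

lemma ex_good_levels: "\<exists>g. \<forall>\<alpha>. good_level (G \<alpha>) g \<alpha> (g \<alpha>)"
proof (rule dependent_wf_choice[OF wf])
  show "good_level (G \<alpha>) g \<alpha> r = good_level (G \<alpha>) g' \<alpha> r"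
    if "\<And>\<beta>. (\<beta>, \<alpha>) \<in> {(x, y). x < y} \<Longrightarrow> g \<beta> = g' \<beta>" for g g' \<alpha> r
    using that by (intro good_level_cong) simp
  show "\<exists>r. good_level (G \<alpha>) g \<alpha> r"
    if "\<And>\<beta>. (\<beta>, \<alpha>) \<in> {(x, y). x < y} \<Longrightarrow> good_level (G \<beta>) g \<beta> (g \<beta>)" for g \<alpha>
    using that by (intro ex_good_level) simp
qed

section \<open>The tree built from a diamond sequence\<close>

theorem theorem5p5:
  assumes "diamond"
  shows "\<exists>(T :: omega1 set) (lt :: omega1 \<Rightarrow> omega1 \<Rightarrow> bool).
           aleph1_tree T lt \<and> special_tree T lt \<and> Lindelof_space (fine_wedge_topology T lt)"
proof -
  obtain A :: "omega1 \<Rightarrow> omega1 set" where A: "\<And>X. stationary {\<alpha>. X \<inter> {..<\<alpha>} = A \<alpha>}"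
    using assms unfolding diamond_def by blast
  obtain N :: "omega1 \<times> nat \<Rightarrow> omega1" where N: "bij N"
    using ex_bij_omega1_times_nat by blast
  \<comment> \<open>The guesses are pulled back from codes to pairs of level and index.\<close>
  obtain g where g: "\<And>\<alpha>. good_level (N -` A \<alpha>) g \<alpha> (g \<alpha>)"
    using ex_good_levels[of "\<lambda>\<alpha>. N -` A \<alpha>"] by blast
  define p where "p \<alpha> = fst (g \<alpha>)" for \<alpha>
  have p_self: "p \<alpha> n \<alpha> = n" for \<alpha> n
    using g[of \<alpha>] by (simp add: good_level_def p_def)
  interpret indexed_tree N p
  proof
    show "p \<beta> (p \<alpha> n \<beta>) \<gamma> = p \<alpha> n \<gamma>" if "\<gamma> \<le> \<beta>" "\<beta> \<le> \<alpha>" for \<alpha> \<beta> \<gamma> n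
      using that g[of \<alpha>] p_self
      by (cases "\<beta> = \<alpha>") (auto simp: good_level_def coherent_def p_def)
  qed (use N p_self in auto)
  have "special_tree UNIV lt"
  proof (rule special_treeI)
    \<comment> \<open>The labels specialise the tree: coherence puts the labels of all predecessors
      of \<open>y\<close> below that of \<open>y\<close>.\<close>
    show "snd (g (lev x)) (idx x) < snd (g (lev y)) (idx y)" if "lt x y" for x y
    proof -
      have "coherent g (lev y) (snd (g (lev y)) (idx y)) (proj y)"
        using g[of "lev y"] by (simp add: good_level_def proj_def p_def)
      then show ?thesis
        using that by (auto simp: coherent_def lt_def)
    qed
  qed
  moreover have "Lindelof_space (fine_wedge_topology UNIV lt)"
  proof (rule Lindelof_space_fine_wedge[OF A])
    fix \<alpha> n
    assume "\<exists>\<beta>. \<beta> < \<alpha>" "\<And>\<beta>. \<beta> < \<alpha> \<Longrightarrow> suc_omega1 \<beta> < \<alpha>"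
      "\<And>\<beta> m. \<beta> < \<alpha> \<Longrightarrow>
        finite {k. N (suc_omega1 \<beta>, k) \<in> A \<alpha> \<and> p (suc_omega1 \<beta>) k \<beta> = m}"
    then show "\<exists>\<beta><\<alpha>. N (suc_omega1 \<beta>, p \<alpha> n (suc_omega1 \<beta>)) \<notin> A \<alpha>"
      using g[of \<alpha>] by (auto simp: good_level_def small_guess_def leaves_guess_def p_def)
  qed
  ultimately show ?thesis
    using aleph1_tree by blast
qed

end
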